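(* Let $N\ge 0$ be an integer. For generic complex parameters $a,b,c,d,q$ (i.e. on a nonempty Zariski-open set of parameters), there are unique coefficients $R_k^l=R_k^l(a,b,c,d;N;q)$, $0\le k,l\le N$, such that for each $k$ $$h_k(x;a)h_{N-k}(x;b)=\sum_{l=0}^N R_k^l(a,b,c,d;N;q)\,h_l(x;c)h_{N-l}(x;d)$$ as polynomials in $x$, and they are given by $$R_k^l=q^{l(l-N)}\binom{N}{l}_q\frac{(ac,a/c;q)_k\,(q^{N-l}bd,b/d;q)_l\,(b/c;q)_{N-k}\,(b/c;q)_{N-l}\,(bc;q)_{N-k}}{(q^{l-N}c/d;q)_l\,(q^{-l}d/c;q)_{N-l}\,(cd;q)_N\,(b/c;q)_N\,(bc;q)_l}$$ $$\times{}_{10}W_9\big(q^{-N}c/b;\,q^{-k},q^{-l},q^{k-N}a/b,q^{l-N}c/d,cd,q^{1-N}/(ab),qc/b;\,q,q\big).$$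
   Context: $(a;q)_k=\prod_{j=0}^{k-1}(1-aq^j)$, $(a_1,\dots,a_n;q)_k=\prod_i(a_i;q)_k$, $\binom{N}{l}_q=\frac{(q;q)_N}{(q;q)_l(q;q)_{N-l}}$. $h_k(x;a)=\prod_{j=0}^{k-1}(1-axq^j+a^2q^{2j})$. ${}_{r+1}W_r(a;b_1,\dots,b_{r-2};q,z)=\sum_{k\ge0}\frac{1-aq^{2k}}{1-a}\frac{(a,b_1,\dots,b_{r-2};q)_k}{(q,aq/b_1,\dots,aq/b_{r-2};q)_k}z^k$ (terminating here because of the parameter $q^{-k}$). *)

theory Defs
  imports Complex_Main "HOL-Computational_Algebra.Polynomial"
begin

definition qpoch :: "complex \<Rightarrow> complex \<Rightarrow> nat \<Rightarrow> complex" where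
  "qpoch a q k = (\<Prod>j<k. 1 - a * q ^ j)"

definition qbinom :: "nat \<Rightarrow> nat \<Rightarrow> complex \<Rightarrow> complex" where
  "qbinom N l q = qpoch q q N / (qpoch q q l * qpoch q q (N - l))"

definition h_poly :: "nat \<Rightarrow> complex \<Rightarrow> complex \<Rightarrow> complex poly" where
  "h_poly k a q = (\<Prod>j<k. [:1 + a^2 * q^(2*j), - a * q^j:])"

definition vwp_term :: "complex \<Rightarrow> complex list \<Rightarrow> complex \<Rightarrow> complex \<Rightarrow> nat \<Rightarrow> complex" where
  "vwp_term a bs q z n =
     (1 - a * q^(2*n)) / (1 - a) *
     (qpoch a q n * (\<Prod>b\<leftarrow>bs. qpoch b q n)) /
     (qpoch q q n * (\<Prod>b\<leftarrow>bs. qpoch (a * q / b) q n)) * z ^ n"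

definition vwpW :: "complex \<Rightarrow> complex list \<Rightarrow> complex \<Rightarrow> complex \<Rightarrow> complex" where
  "vwpW a bs q z = (\<Sum>n. vwp_term a bs q z n)"

text \<open>Evaluation of a polynomial in the five variables (a,b,c,d,q), given by a
  finitely supported coefficient function on exponent tuples.\<close>
definition mpoly5_eval ::
  "(nat \<times> nat \<times> nat \<times> nat \<times> nat \<Rightarrow> complex) \<Rightarrow> complex \<Rightarrow> complex \<Rightarrow> complex \<Rightarrow> complex \<Rightarrow> complex \<Rightarrow> complex" where
  "mpoly5_eval C a b c d q =
     (\<Sum>e\<in>{e. C e \<noteq> 0}. case e of (i, j, k, l, m) \<Rightarrow> C e * a^i * b^j * c^k * d^l * q^m)"

definition Rcoef :: "complex \<Rightarrow> complex \<Rightarrow> complex \<Rightarrow> complex \<Rightarrow> nat \<Rightarrow> complex \<Rightarrow> nat \<Rightarrow> nat \<Rightarrow> complex" where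
  "Rcoef a b c d N q k l =
     q powi (int l * (int l - int N)) * qbinom N l q *
     (qpoch (a*c) q k * qpoch (a/c) q k * qpoch (q^(N-l) * b * d) q l * qpoch (b/d) q l *
      qpoch (b/c) q (N-k) * qpoch (b/c) q (N-l) * qpoch (b*c) q (N-k)) /
     (qpoch (q powi (int l - int N) * c / d) q l * qpoch (q powi (- int l) * d / c) q (N-l) *
      qpoch (c*d) q N * qpoch (b/c) q N * qpoch (b*c) q l) *
     vwpW (q powi (- int N) * c / b)
       [q powi (- int k), q powi (- int l), q powi (int k - int N) * a / b,
        q powi (int l - int N) * c / d, c * d, q powi (1 - int N) / (a * b), q * c / b] q q"

end

theory Submission
  imports Defs
begin

text \<open>
  Extracting one factor at a time shows that \<open>h_n(x;a)\<close> expands in the products \<open>h_l(x;b) h_{n-l}(x;c)\<close> with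
  coefficients that are pure products of $q$-shifted factorials. Apply this twice: first expand \<open>h_k(x;a)\<close> in
  \<open>h_j(x;c) h_{k-j}(x;bq^{N-k})\<close>, so that multiplication by \<open>h_{N-k}(x;b)\<close> gives \<open>h_j(x;c) h_{N-j}(x;b)\<close>;
  then expand \<open>h_{N-j}(x;b)\<close> in \<open>h_i(x;cq^j) h_{N-j-i}(x;d)\<close>, which yields \<open>h_{j+i}(x;c) h_{N-j-i}(x;d)\<close>.
  Collecting \<open>j + i = l\<close>, the coefficient is a sum over \<open>j\<close> whose consecutive terms have the ratio of those of the
  very-well-poised series. Uniqueness follows by evaluating at \<open>x = c + 1/c\<close>, where \<open>h_l(x;c)\<close> vanishes for \<open>l > 0\<close>,
  and dividing by the common factor.
\<close>

section \<open>Shifted factorials and the polynomials \<open>h_poly\<close>\<close>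

lemma qpoch_0 [simp]: "qpoch a q 0 = 1"
  by (simp add: qpoch_def)

lemma qpoch_Suc: "qpoch a q (Suc n) = qpoch a q n * (1 - a * q ^ n)"
  by (simp add: qpoch_def)

lemma qpoch_Suc_shift: "qpoch a q (Suc n) = (1 - a) * qpoch (a * q) q n"
  by (simp only: qpoch_def prod.lessThan_Suc_shift) (simp add: mult_ac)

lemma qpoch_add: "qpoch a q (m + n) = qpoch a q m * qpoch (a * q ^ m) q n"
  by (induction n) (simp_all add: qpoch_Suc power_add mult_ac)

lemma qpoch_nonzero: "(\<And>j. j < n \<Longrightarrow> a * q ^ j \<noteq> 1) \<Longrightarrow> qpoch a q n \<noteq> 0"
  by (auto simp: qpoch_def)

lemma qpoch_eq_0: "a * q ^ j = 1 \<Longrightarrow> j < n \<Longrightarrow> qpoch a q n = 0"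
  by (auto simp: qpoch_def)

text \<open>Both sides are \<open>qpoch (z / q) q (Suc m)\<close>, with the last factor split off on
  the left and the first on the right. The product form keeps these factors out of
  denominators.\<close>

lemma qpoch_divide_shift:
  assumes "q \<noteq> 0"
  shows "qpoch (z / q) q m * (1 - z / q * q ^ m) = (1 - z / q) * qpoch z q m"
  using qpoch_Suc[of "z / q" q m] qpoch_Suc_shift[of "z / q" q m] assms by simp

lemma h_poly_0 [simp]: "h_poly 0 a q = 1"
  by (simp add: h_poly_def)

lemma h_poly_Suc: "h_poly (Suc n) a q = h_poly n a q * [:1 + (a * q ^ n)\<^sup>2, - (a * q ^ n):]"
  by (simp add: h_poly_def power_mult_distrib power_even_eq del: mult_pCons_right)

lemma h_poly_add: "h_poly (m + n) a q = h_poly m a q * h_poly n (a * q ^ m) q"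
  by (induction n)
    (simp_all only: add_Suc_right h_poly_Suc power_add mult_ac, simp_all add: mult_ac)

text \<open>Each factor \<open>1 - a x q^j + a^2 q^(2j)\<close> splits at
  \<open>x = y + 1 / y\<close> into \<open>(1 - a y q^j) (1 - a q^j / y)\<close>. This shows whether
  \<open>h_poly\<close> vanishes at a given point.\<close>

lemma poly_h_poly_Joukowski:
  assumes "y \<noteq> 0"
  shows "poly (h_poly n a q) (y + 1 / y) = qpoch (a * y) q n * qpoch (a / y) q n"
proof (induction n)
  case (Suc n)
  have "poly [:1 + (a * q ^ n)\<^sup>2, - (a * q ^ n):] (y + 1 / y) =
    (1 - a * y * q ^ n) * (1 - a / y * q ^ n)"
    using assms by (simp add: field_simps power2_eq_square)
  then show ?case
    using Suc by (simp only: h_poly_Suc poly_mult qpoch_Suc) (simp add: mult_ac)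
qed simp

section \<open>Generic pairs of parameters\<close>

text \<open>The inequations keep the factors of the shifted factorials of \<open>x * y\<close>,
  \<open>x / y\<close> and \<open>y / x\<close> away from zero up to exponent \<open>n\<close>. They
  are written without division so that they can be read as nonvanishing of polynomials.\<close>

definition generic_pair :: "nat \<Rightarrow> complex \<Rightarrow> complex \<Rightarrow> complex \<Rightarrow> bool" where
  "generic_pair n q x y \<longleftrightarrow> x \<noteq> 0 \<and> y \<noteq> 0 \<and>
     (\<forall>j\<le>n. x * y * q ^ j \<noteq> 1 \<and> x \<noteq> y * q ^ j \<and> y \<noteq> x * q ^ j)"

lemma generic_pair_commute: "generic_pair n q x y \<longleftrightarrow> generic_pair n q y x"
  by (auto simp: generic_pair_def mult.commute)

lemma generic_pair_mono: "generic_pair n q x y \<Longrightarrow> m \<le> n \<Longrightarrow> generic_pair m q x y"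
  by (auto simp: generic_pair_def)

text \<open>Cancelling the smaller power of \<open>q\<close> leaves one of the two inequations
  between \<open>x\<close> and \<open>y\<close> in the definition.\<close>

lemma generic_pair_power_neq:
  assumes "generic_pair n q x y" "q \<noteq> 0" "i \<le> n" "j \<le> n"
  shows "x * q ^ i \<noteq> y * q ^ j"
proof (cases "i \<le> j")
  case True
  then have "y * q ^ j = y * q ^ (j - i) * q ^ i"
    by (simp flip: power_add)
  moreover have "j - i \<le> n" "q ^ i \<noteq> 0"
    using assms by auto
  ultimately show ?thesis
    using assms(1) by (metis generic_pair_def mult_right_cancel)
next
  case False
  then have "x * q ^ i = x * q ^ (i - j) * q ^ j"
    by (simp flip: power_add)
  moreover have "i - j \<le> n" "q ^ j \<noteq> 0"
    using assms by auto
  ultimately show ?thesis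
    using assms(1) by (metis generic_pair_def mult_right_cancel)
qed

text \<open>The shift uses up \<open>i\<close> of the available exponents. The last inequation has
  powers of \<open>q\<close> on both sides and therefore comes from
  \<open>generic_pair_power_neq\<close>.\<close>

lemma generic_pair_shift:
  assumes "generic_pair (n + i) q x y" "q \<noteq> 0"
  shows "generic_pair n q x (y * q ^ i)"
  unfolding generic_pair_def
proof (intro conjI allI impI)
  fix j assume j: "j \<le> n"
  have *: "x * y * q ^ (j + i) \<noteq> 1" "x \<noteq> y * q ^ (i + j)"
    using assms(1) j unfolding generic_pair_def by auto
  show "x * (y * q ^ i) * q ^ j \<noteq> 1" "x \<noteq> y * q ^ i * q ^ j"
    using * by (simp_all add: power_add mult_ac)
  show "y * q ^ i \<noteq> x * q ^ j"
    using generic_pair_power_neq[OF assms, of j i] j by auto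
qed (use assms in \<open>auto simp: generic_pair_def\<close>)

lemma generic_pairD:
  assumes "generic_pair n q x y" "j \<le> n"
  shows "1 - x * y * q ^ j \<noteq> 0" "1 - x / y * q ^ j \<noteq> 0" "1 - y / x * q ^ j \<noteq> 0"
  using assms by (auto simp: generic_pair_def field_simps)

lemma generic_pair_diff:
  assumes "generic_pair n q x y" "q \<noteq> 0" "i \<le> n" "j \<le> n"
  shows "q ^ i - x / y * q ^ j \<noteq> 0"
  using generic_pair_power_neq[OF assms(1,2,4,3)] assms(1)
  by (auto simp: generic_pair_def field_simps)

lemma qpoch_q_nonzero:
  assumes "\<And>j. j < n \<Longrightarrow> q ^ Suc j \<noteq> (1 :: complex)"
  shows "qpoch q q n \<noteq> 0"
  using assms by (intro qpoch_nonzero) simp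

subsection \<open>The $q$-binomial expansion\<close>

text \<open>
  The very-well-poised form: apart from the linear factor, the dependence on \<open>l\<close>, \<open>m\<close> and \<open>l + m\<close> separates.
\<close>
definition qb_coeff :: "complex \<Rightarrow> complex \<Rightarrow> complex \<Rightarrow> complex \<Rightarrow> nat \<Rightarrow> nat \<Rightarrow> complex" where
  "qb_coeff a b c q l m =
     qpoch q q (l + m) * qpoch (a * c) q (l + m) * qpoch (a * b) q (l + m) / qpoch (b * c) q (l + m) *
     (q ^ m - b / c * q ^ l) *
     (qpoch (a / c) q l / (qpoch q q l * qpoch (a * b) q l * qpoch (b / c) q (Suc l))) *
     (qpoch (a / b) q m / (qpoch q q m * qpoch (a * c) q m * qpoch (c / b * q) q m))"

text \<open>With \<open>u = q^l\<close>, \<open>v = q^m\<close> and \<open>w = q^(l+m+1)\<close>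
  this is the Pascal-type recurrence for \<open>qb_coeff\<close> at \<open>(Suc l, Suc m)\<close>,
  freed of common factors. The terms on the right come from \<open>(l, Suc m)\<close> and
  \<open>(Suc l, m)\<close>. The identity is a partial fraction decomposition.\<close>

lemma qb_recurrence_identity:
  fixes a b c q u v :: complex
  assumes "b \<noteq> 0" "c \<noteq> 0"
    and "1 - q * u \<noteq> 0" "1 - a * b * u \<noteq> 0" "1 - b / c * (q * u) \<noteq> 0"
    and "1 - q * v \<noteq> 0" "1 - a * c * v \<noteq> 0" "1 - c / b * q * v \<noteq> 0"
  defines "w \<equiv> q * u * v"
  shows "(1 - q * w) * (1 - a * c * w) * (1 - a * b * w) * (q * v - b / c * (q * u)) *
      ((1 - a / c * u) / ((1 - q * u) * (1 - a * b * u) * (1 - b / c * (q * u)))) *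
      ((1 - a / b * v) / ((1 - q * v) * (1 - a * c * v) * (1 - c / b * q * v))) =
    ((1 - a / b * v) / ((1 - q * v) * (1 - a * c * v) * (1 - c / b * q * v))) *
      ((1 - a * w * (c * (q * v))) * (c * (q * v) - a * w) / c) -
    ((1 - a / c * u) / ((1 - q * u) * (1 - a * b * u) * (1 - b / c * (q * u)))) *
      ((1 - a * w * (b * (q * u))) * (b * (q * u) - a * w) / c)"
proof -
  define X where "X = (1 - q * u) * (1 - a * b * u) * (1 - b / c * (q * u))"
  define Y where "Y = (1 - q * v) * (1 - a * c * v) * (1 - c / b * q * v)"
  have nz: "X \<noteq> 0" "Y \<noteq> 0"
    using assms by (simp_all add: X_def Y_def)
  \<comment> \<open>These differences reproduce the numerators \<open>1 - a / c * u\<close> and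
    \<open>1 - a / b * v\<close> of the left side, so that only a relation between \<open>X\<close>
    and \<open>Y\<close> remains.\<close>
  have 1: "c * (q * v) - a * w = c * q * v * (1 - a / c * u)"
    "b * (q * u) - a * w = b * q * u * (1 - a / b * v)"
    using assms(1,2) by (simp_all add: w_def field_simps)
  \<comment> \<open>The numerator is a combination of \<open>X\<close> and \<open>Y\<close>;
    dividing by \<open>X * Y\<close> gives the two partial fractions. The relation is first proved
    with the denominators \<open>b\<close> and \<open>c\<close> cleared, as a polynomial
    identity.\<close>
  have 2: "(1 - q * w) * (1 - a * c * w) * (1 - a * b * w) * (q * v - b / c * (q * u)) =
     (1 - a * w * (c * (q * v))) * q * v * X - (1 - a * w * (b * (q * u))) * (b / c) * q * u * Y"
  proof -
    have "(1 - q * w) * (1 - a * c * w) * (1 - a * b * w) * (q * v * c - b * (q * u)) =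
     (1 - a * w * (c * (q * v))) * q * v * ((1 - q * u) * (1 - a * b * u) * (c - b * (q * u)))
     - (1 - a * w * (b * (q * u))) * q * u * ((1 - q * v) * (1 - a * c * v) * (b - c * q * v))"
      unfolding w_def by algebra
    moreover have "c * X = (1 - q * u) * (1 - a * b * u) * (c - b * (q * u))"
      "b * Y = (1 - q * v) * (1 - a * c * v) * (b - c * q * v)"
      using assms(1,2) by (simp_all add: X_def Y_def field_simps)
    ultimately have "(1 - q * w) * (1 - a * c * w) * (1 - a * b * w) * (q * v * c - b * (q * u)) =
     (1 - a * w * (c * (q * v))) * q * v * (c * X) - (1 - a * w * (b * (q * u))) * q * u * (b * Y)"
      by simp
    moreover have "q * v * c - b * (q * u) = c * (q * v - b / c * (q * u))"
      using assms(2) by (simp add: right_diff_distrib)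
    ultimately have "(1 - q * w) * (1 - a * c * w) * (1 - a * b * w) * (c * (q * v - b / c * (q * u))) =
     (1 - a * w * (c * (q * v))) * q * v * (c * X) - (1 - a * w * (b * (q * u))) * q * u * (b * Y)"
      by simp
    moreover have "Z * D = P * X - R * (b / c) * q * u * Y"
      if "Z * (c * D) = P * (c * X) - R * q * u * (b * Y)" for Z D P R
      using that assms(2) by (simp add: field_simps)
    ultimately show ?thesis
      by blast
  qed
  have "(P * q * v * X - R * (b / c) * q * u * Y) * (S / X) * (T / Y) =
    (T / Y) * (P * (c * q * v * S) / c) - (S / X) * (R * (b * q * u * T) / c)" for P R S T
    using nz assms(1,2) by (simp add: divide_simps) (simp add: algebra_simps)
  then show ?thesis
    unfolding X_def[symmetric] Y_def[symmetric] 1 2 .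
qed


text \<open>Induction on the degree: the next linear factor of the left side is a combination of the
  next factors of \<open>h_poly l b q\<close> and \<open>h_poly m c q\<close>, and the coefficients
  satisfy the resulting recurrence.\<close>

theorem h_poly_expansion:
  assumes q: "q \<noteq> 0" "\<And>j. j < n \<Longrightarrow> q ^ Suc j \<noteq> 1"
    and gen: "generic_pair n q a b" "generic_pair n q a c" "generic_pair n q b c"
  shows "h_poly n a q =
    (\<Sum>l\<le>n. smult (qb_coeff a b c q l (n - l)) (h_poly l b q * h_poly (n - l) c q))"
proof -
  have bc: "b \<noteq> 0" "c \<noteq> 0"
    using gen by (auto simp: generic_pair_def)
  define G where "G n = qpoch q q n * qpoch (a * c) q n * qpoch (a * b) q n / qpoch (b * c) q n" for n
  define U where "U l = qpoch (a / c) q l / (qpoch q q l * qpoch (a * b) q l * qpoch (b / c) q (Suc l))" for l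
  define V where "V m = qpoch (a / b) q m / (qpoch q q m * qpoch (a * c) q m * qpoch (c / b * q) q m)" for m
  \<comment> \<open>\<open>\<alpha>\<close> and \<open>\<beta>\<close> are the shares of the
    coefficient at \<open>(l, m)\<close> that pass to \<open>(Suc l, m)\<close> and to
    \<open>(l, Suc m)\<close>.\<close>
  define \<alpha> where "\<alpha> l m = G (l + m) * U l * V m / (1 - b * c * q ^ (l + m)) *
    ((1 - a * q ^ (l + m) * (c * q ^ m)) * (c * q ^ m - a * q ^ (l + m)) / c)" for l m
  define \<beta> where "\<beta> l m = - (G (l + m) * U l * V m / (1 - b * c * q ^ (l + m))) *
    ((1 - a * q ^ (l + m) * (b * q ^ l)) * (b * q ^ l - a * q ^ (l + m)) / c)" for l m
  have C: "qb_coeff a b c q l m = G (l + m) * (q ^ m - b / c * q ^ l) * U l * V m" for l m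
    by (simp add: qb_coeff_def G_def U_def V_def)
  have G_Suc: "G (Suc i) = G i / (1 - b * c * q ^ i) *
      ((1 - q * q ^ i) * (1 - a * c * q ^ i) * (1 - a * b * q ^ i))" for i
    by (simp add: G_def qpoch_Suc)
  have U_Suc: "U (Suc i) = U i *
      ((1 - a / c * q ^ i) / ((1 - q * q ^ i) * (1 - a * b * q ^ i) * (1 - b / c * (q * q ^ i))))" for i
    by (simp add: U_def qpoch_Suc)
  have V_Suc: "V (Suc i) = V i *
      ((1 - a / b * q ^ i) / ((1 - q * q ^ i) * (1 - a * c * q ^ i) * (1 - c / b * q * q ^ i)))" for i
    by (simp add: V_def qpoch_Suc)
  have nz: "1 - q * q ^ i \<noteq> 0" "1 - a * b * q ^ i \<noteq> 0" "1 - b / c * (q * q ^ i) \<noteq> 0"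
     "1 - a * c * q ^ i \<noteq> 0" "1 - c / b * q * q ^ i \<noteq> 0" "1 - b * c * q ^ i \<noteq> 0" if "i < n" for i
    using generic_pairD[OF gen(1), of i] generic_pairD[OF gen(2), of i] generic_pairD[OF gen(3), of i]
      generic_pairD[OF gen(3), of "Suc i"] q(2)[of i] that by (auto simp: mult.assoc)
  have split: "smult (qb_coeff a b c q l m) [:1 + (a * q ^ (l + m))\<^sup>2, - (a * q ^ (l + m)):] =
     smult (\<alpha> l m) [:1 + (b * q ^ l)\<^sup>2, - (b * q ^ l):] +
     smult (\<beta> l m) [:1 + (c * q ^ m)\<^sup>2, - (c * q ^ m):]" if "l + m < n" for l m
  proof -
    define A B D where "A = a * q ^ (l + m)" and "B = b * q ^ l" and "D = c * q ^ m"
    define W where "W = G (l + m) * U l * V m"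
    have BD: "b * c * q ^ (l + m) = B * D"
      by (simp add: B_def D_def power_add)
    have nz': "1 - B * D \<noteq> 0"
      using nz(6)[OF that] unfolding BD .
    have "q ^ m - b / c * q ^ l = (D - B) / c"
      using bc by (simp add: B_def D_def field_simps)
    then have C': "qb_coeff a b c q l m = W * (D - B) / c"
      by (simp add: C W_def)
    have ab: "\<alpha> l m = W / (1 - B * D) * ((1 - A * D) * (D - A) / c)"
      "\<beta> l m = - (W / (1 - B * D)) * ((1 - A * B) * (B - A) / c)"
      unfolding \<alpha>_def \<beta>_def BD by (simp_all add: A_def B_def D_def W_def)
    \<comment> \<open>Cramer's rule for writing the pair \<open>(1 + A^2, A)\<close> in terms of
      \<open>(1 + B^2, B)\<close> and \<open>(1 + D^2, D)\<close>; the determinant is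
      \<open>(D - B) * (1 - B * D)\<close>.\<close>
    have id1: "(D - B) * (1 - B * D) * (1 + A\<^sup>2) =
        (1 - A * D) * (D - A) * (1 + B\<^sup>2) - (1 - A * B) * (B - A) * (1 + D\<^sup>2)"
      "(D - B) * (1 - B * D) * A = (1 - A * D) * (D - A) * B - (1 - A * B) * (B - A) * D"
      by algebra+
    have gen: "W * (D - B) / c * Z = W / (1 - B * D) * (S / c) * X + - (W / (1 - B * D)) * (T / c) * Y"
      if "(D - B) * (1 - B * D) * Z = S * X - T * Y" for Z S T X Y
    proof -
      have "W * (D - B) / c * Z = W / (1 - B * D) / c * ((D - B) * (1 - B * D) * Z)"
        using nz' bc by simp
      then show ?thesis
        unfolding that by (simp add: right_diff_distrib diff_divide_distrib mult.assoc)
    qed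
    show ?thesis
      unfolding A_def[symmetric] B_def[symmetric] D_def[symmetric] C' ab
      using gen[OF id1(1)] gen[OF id1(2)] by simp
  qed
  \<comment> \<open>An interior product is reached in two ways, by raising the first or the second
    index.\<close>
  have rec: "qb_coeff a b c q (Suc l) (Suc m) = \<alpha> l (Suc m) + \<beta> (Suc l) m" if "l + m + 1 < n" for l m
  proof -
    let ?w = "q * q ^ l * q ^ m"
    let ?W = "G (Suc (l + m)) / (1 - b * c * ?w) * U l * V m"
    note id = qb_recurrence_identity[of b c q "q ^ l" a "q ^ m", OF bc]
    have "qb_coeff a b c q (Suc l) (Suc m) = ?W *
      ((1 - q * ?w) * (1 - a * c * ?w) * (1 - a * b * ?w) * (q * q ^ m - b / c * (q * q ^ l)) *
      ((1 - a / c * q ^ l) / ((1 - q * q ^ l) * (1 - a * b * q ^ l) * (1 - b / c * (q * q ^ l)))) *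
      ((1 - a / b * q ^ m) / ((1 - q * q ^ m) * (1 - a * c * q ^ m) * (1 - c / b * q * q ^ m))))"
      unfolding C add_Suc add_Suc_right U_Suc V_Suc G_Suc[of "Suc _"] power_Suc power_add
      by (simp only: mult_ac times_divide_eq_left times_divide_eq_right divide_divide_eq_left)
    also have "\<dots> = \<alpha> l (Suc m) + \<beta> (Suc l) m"
    proof -
      have w: "q ^ Suc (l + m) = ?w"
        by (simp add: power_add)
      have lin: "W / z * x * y * (y' * P - x' * R) = W * x * (y * y') / z * P + - (W * (x * x') * y / z) * R"
        for W z x y x' y' P R :: complex
        by (simp add: right_diff_distrib diff_divide_distrib mult_ac)
      show ?thesis
        unfolding \<alpha>_def \<beta>_def add_Suc add_Suc_right w U_Suc V_Suc power_Suc[of q m] power_Suc[of q l] lin[symmetric]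
        by (subst id) (use that nz[of l] nz[of m] in auto)
    qed
    finally show ?thesis .
  qed
  \<comment> \<open>On the edge \<open>l = 0\<close> only \<open>\<beta>\<close> contributes. Up to
    \<open>- (b / c)\<close>, the linear factor of the coefficient is the new denominator factor of
    \<open>V (Suc m)\<close> and cancels it.\<close>
  have rec_0: "qb_coeff a b c q 0 (Suc m) = \<beta> 0 m" if "m < n" for m
  proof -
    have "q * q ^ m - b / c = - (b / c) * (1 - c / b * q * q ^ m)"
      "b - a * q ^ m = b * (1 - a / b * q ^ m)"
      using bc by (simp_all add: field_simps)
    moreover have "a * q ^ m * b = a * b * q ^ m"
      by simp
    moreover have "G0 / z * (Q * AC * AB) * (- (b / c) * t) * U0 * (V0 * (s / (Q * AC * t))) =
       - (G0 * U0 * V0 / z) * (AB * (b * s) / c)" if "Q \<noteq> 0" "AC \<noteq> 0" "t \<noteq> 0"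
      for G0 z Q AC AB t U0 V0 s
      using that by simp
    ultimately show ?thesis
      unfolding \<beta>_def C add_0 V_Suc G_Suc power_Suc power_0 mult_1_right
      using nz[OF that] by presburger
  qed
  \<comment> \<open>On the other edge the linear factor is itself the new denominator factor of
    \<open>U (Suc l)\<close>.\<close>
  have rec_0': "qb_coeff a b c q (Suc l) 0 = \<alpha> l 0" if "l < n" for l
  proof -
    have "c - a * q ^ l = c * (1 - a / c * q ^ l)"
      using bc by (simp add: field_simps)
    moreover have "a * q ^ l * c = a * c * q ^ l"
      by simp
    moreover have "G0 / z * (Q * AC * AB) * t * (U0 * (s / (Q * AB * t))) * V0 =
       G0 * U0 * V0 / z * (AC * (c * s) / c)" if "Q \<noteq> 0" "AB \<noteq> 0" "t \<noteq> 0"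
      for G0 z Q AC AB t U0 V0 s
      using that bc by simp
    ultimately show ?thesis
      unfolding \<alpha>_def C add_0_right U_Suc G_Suc power_Suc power_0 mult_1_right
      using nz[OF that] by presburger
  qed
  \<comment> \<open>The induction runs over \<open>i\<close> below a fixed \<open>n\<close>, so that
    the genericity assumptions for \<open>n\<close> serve every step.\<close>
  have "h_poly i a q =
    (\<Sum>l\<le>i. smult (qb_coeff a b c q l (i - l)) (h_poly l b q * h_poly (i - l) c q))" if "i \<le> n" for i
    using that
  proof (induction i)
    case 0
    have "1 - b / c \<noteq> 0"
      using generic_pairD(2)[OF gen(3), of 0] by simp
    then show ?case
      by (simp add: qb_coeff_def qpoch_Suc)
  next
    case (Suc i)
    let ?H = "\<lambda>l m. h_poly l b q * h_poly m c q"
    have "h_poly (Suc i) a q = (\<Sum>l\<le>i. smult (qb_coeff a b c q l (i - l)) (?H l (i - l))) *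
      [:1 + (a * q ^ i)\<^sup>2, - (a * q ^ i):]"
      using Suc by (simp only: h_poly_Suc)
    also have "\<dots> = (\<Sum>l\<le>i. ?H l (i - l) * smult (qb_coeff a b c q l (i - l)) [:1 + (a * q ^ i)\<^sup>2, - (a * q ^ i):])"
      by (simp only: sum_distrib_right mult_smult_left mult_smult_right)
    also have "\<dots> = (\<Sum>l\<le>i. smult (\<alpha> l (i - l)) (?H (Suc l) (i - l)) + smult (\<beta> l (i - l)) (?H l (Suc (i - l))))"
    proof (intro sum.cong refl)
      fix l assume "l \<in> {..i}"
      then have l: "l + (i - l) = i" "l + (i - l) < n"
        using Suc.prems by auto
      show "?H l (i - l) * smult (qb_coeff a b c q l (i - l)) [:1 + (a * q ^ i)\<^sup>2, - (a * q ^ i):] =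
        smult (\<alpha> l (i - l)) (?H (Suc l) (i - l)) + smult (\<beta> l (i - l)) (?H l (Suc (i - l)))"
        using split[OF l(2)] unfolding l(1)
        by (simp only: h_poly_Suc distrib_left mult_smult_right mult_smult_left mult_ac)
    qed
    also have "\<dots> = (\<Sum>l\<le>i. smult (\<alpha> l (i - l)) (?H (Suc l) (i - l))) +
        (\<Sum>l\<le>i. smult (\<beta> l (i - l)) (?H l (Suc i - l)))"
      by (simp add: sum.distrib Suc_diff_le)
    \<comment> \<open>Splitting off the last term of the first sum and the first term of the second
      lines up the rest on the products \<open>?H (Suc l) (i - l)\<close>.\<close>
    also have "\<dots> = (\<Sum>l<i. smult (\<alpha> l (i - l)) (?H (Suc l) (i - l))) + smult (\<alpha> i 0) (?H (Suc i) 0) +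
        (smult (\<beta> 0 i) (?H 0 (Suc i)) + (\<Sum>l<i. smult (\<beta> (Suc l) (i - Suc l)) (?H (Suc l) (i - l))))"
    proof -
      have "(\<Sum>l\<le>i. f l) = (\<Sum>l<i. f l) + f i" "(\<Sum>l\<le>i. f l) = f 0 + (\<Sum>l<i. f (Suc l))"
        for f :: "nat \<Rightarrow> complex poly"
        by (simp_all add: lessThan_Suc_atMost[symmetric] sum.lessThan_Suc_shift flip: sum.lessThan_Suc)
      from this(1)[of "\<lambda>l. smult (\<alpha> l (i - l)) (?H (Suc l) (i - l))"]
        this(2)[of "\<lambda>l. smult (\<beta> l (i - l)) (?H l (Suc i - l))"]
      show ?thesis
        by simp
    qed
    also have "\<dots> = smult (\<beta> 0 i) (?H 0 (Suc i)) +
        (\<Sum>l<i. smult (\<alpha> l (i - l) + \<beta> (Suc l) (i - Suc l)) (?H (Suc l) (i - l))) + smult (\<alpha> i 0) (?H (Suc i) 0)"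
      by (simp add: sum.distrib smult_add_left)
    also have "(\<Sum>l<i. smult (\<alpha> l (i - l) + \<beta> (Suc l) (i - Suc l)) (?H (Suc l) (i - l))) =
        (\<Sum>l<i. smult (qb_coeff a b c q (Suc l) (i - l)) (?H (Suc l) (i - l)))"
    proof (intro sum.cong refl)
      fix l assume "l \<in> {..<i}"
      then show "smult (\<alpha> l (i - l) + \<beta> (Suc l) (i - Suc l)) (?H (Suc l) (i - l)) =
         smult (qb_coeff a b c q (Suc l) (i - l)) (?H (Suc l) (i - l))"
        using rec[of l "i - Suc l"] Suc.prems by (simp add: Suc_diff_Suc)
    qed
    also have "smult (\<beta> 0 i) (?H 0 (Suc i)) +
        (\<Sum>l<i. smult (qb_coeff a b c q (Suc l) (i - l)) (?H (Suc l) (i - l))) + smult (\<alpha> i 0) (?H (Suc i) 0) =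
        (\<Sum>l\<le>Suc i. smult (qb_coeff a b c q l (Suc i - l)) (?H l (Suc i - l)))"
    proof -
      have "(\<Sum>l\<le>Suc i. f l) = f 0 + (\<Sum>l<i. f (Suc l)) + f (Suc i)" for f :: "nat \<Rightarrow> complex poly"
        by (simp only: sum.atMost_Suc) (simp only: lessThan_Suc_atMost[symmetric] sum.lessThan_Suc_shift)
      then show ?thesis
        using rec_0[of i] rec_0'[of i] Suc.prems by simp
    qed
    finally show ?case .
  qed
  then show ?thesis
    by simp
qed

subsection \<open>Linear independence\<close>

lemma h_poly_Suc_shift: "h_poly (Suc n) a q = [:1 + a\<^sup>2, - a:] * h_poly n (a * q) q"
  using h_poly_add[of 1 n a q] by (simp add: h_poly_Suc[of 0])

text \<open>Induction on \<open>n\<close> with \<open>c\<close> replaced by \<open>c * q\<close>.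
  The conditions carry two exponents so that those for \<open>c * q\<close> and \<open>n\<close> are
  instances of those for \<open>c\<close> and \<open>Suc n\<close>, with \<open>i\<close> raised by
  one.\<close>

lemma h_poly_products_independent:
  assumes "q \<noteq> 0" "c \<noteq> 0"
    and "\<And>i j. i + j < n \<Longrightarrow> d * c * q ^ (i + j) \<noteq> 1"
    and "\<And>i j. i + j < n \<Longrightarrow> d * q ^ j \<noteq> c * q ^ i"
    and "(\<Sum>l\<le>n. smult (r l) (h_poly l c q * h_poly (n - l) d q)) = 0"
    and "l \<le> n"
  shows "r l = 0"
  using assms(2-)
proof (induction n arbitrary: c r l)
  case 0
  then show ?case by simp
next
  case (Suc n)
  let ?x = "c + 1 / c"
  have fac: "poly [:1 + c\<^sup>2, - c:] ?x = 0"
    using Suc.prems(1) by (simp add: field_simps power2_eq_square)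
  \<comment> \<open>Every term of positive index contains the linear factor that vanishes at
    \<open>?x\<close>; removing it leaves a relation of the same kind for
    \<open>c * q\<close>.\<close>
  have sum: "(\<Sum>l\<le>Suc n. smult (r l) (h_poly l c q * h_poly (Suc n - l) d q)) =
    smult (r 0) (h_poly (Suc n) d q) + [:1 + c\<^sup>2, - c:] *
      (\<Sum>l\<le>n. smult (r (Suc l)) (h_poly l (c * q) q * h_poly (n - l) d q))"
    by (simp only: sum.atMost_Suc_shift h_poly_Suc_shift[of _ c] sum_distrib_left mult_smult_right
        mult.assoc h_poly_0 diff_zero diff_Suc_Suc mult_1)
  have "poly (smult (r 0) (h_poly (Suc n) d q)) ?x = 0"
    using Suc.prems(4) unfolding sum using fac
    by (metis (no_types, lifting) add.right_neutral mult_eq_0_iff poly_0 poly_add poly_mult)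
  moreover have "qpoch (d * c) q (Suc n) \<noteq> 0"
    using Suc.prems(2)[of _ 0] by (intro qpoch_nonzero) auto
  moreover have "qpoch (d / c) q (Suc n) \<noteq> 0"
    using Suc.prems(3)[of 0] Suc.prems(1) by (intro qpoch_nonzero) (auto simp: field_simps)
  ultimately have r0: "r 0 = 0"
    using Suc.prems(1) by (simp add: poly_h_poly_Joukowski)
  have "[:1 + c\<^sup>2, - c:] \<noteq> 0"
    using Suc.prems(1) by simp
  then have sum': "(\<Sum>l\<le>n. smult (r (Suc l)) (h_poly l (c * q) q * h_poly (n - l) d q)) = 0"
    using Suc.prems(4) unfolding sum r0 by (simp only: smult_0_left add_0 mult_eq_0_iff simp_thms)
  have "r (Suc i) = 0" if "i \<le> n" for i
  proof (rule Suc.IH[of "c * q" "\<lambda>l. r (Suc l)" i])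
    show "d * (c * q) * q ^ (i + j) \<noteq> 1" if "i + j < n" for i j
      using Suc.prems(2)[of "Suc i" j] that by (simp add: mult_ac)
    show "d * q ^ j \<noteq> c * q * q ^ i" if "i + j < n" for i j
      using Suc.prems(3)[of "Suc i" j] that by (simp add: mult_ac)
  qed (use assms(1) Suc.prems(1) sum' that in simp_all)
  with r0 Suc.prems(5) show ?case
    by (cases l) auto
qed

subsection \<open>Ratios of coefficients and of very-well-poised terms\<close>

text \<open>Moving one unit from \<open>m\<close> to \<open>l\<close> keeps \<open>l + m\<close>, so
  the part depending on the sum cancels. This gives the ratio of consecutive coefficients in the
  first expansion.\<close>

lemma qb_coeff_move:
  assumes "q ^ Suc l \<noteq> 1" "q ^ Suc m \<noteq> 1"
    and "1 - a * b * q ^ l \<noteq> 0" "1 - a * c * q ^ m \<noteq> 0" "1 - b / c * q ^ Suc l \<noteq> 0"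
      "1 - c / b * q ^ Suc m \<noteq> 0" "1 - a / b * q ^ m \<noteq> 0" "q ^ Suc m - b / c * q ^ l \<noteq> 0"
  shows "qb_coeff a b c q (Suc l) m = qb_coeff a b c q l (Suc m) *
    ((q ^ m - b / c * q ^ Suc l) / (q ^ Suc m - b / c * q ^ l)) *
    ((1 - a / c * q ^ l) / ((1 - q ^ Suc l) * (1 - a * b * q ^ l) * (1 - b / c * q ^ Suc l))) *
    ((1 - q ^ Suc m) * (1 - a * c * q ^ m) * (1 - c / b * q ^ Suc m) / (1 - a / b * q ^ m))"
proof -
  have gen: "G * Y * (A * a1 / (B * b1)) * (C / D) = G * X * (A / B) * (C * c1 / (D * d1)) * (Y / X) * (a1 / b1) * (d1 / c1)"
    if "X \<noteq> 0" "c1 \<noteq> 0" "d1 \<noteq> 0" for G X Y A B C D a1 b1 c1 d1 :: complex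
    using that by (simp add: mult_ac)
  have p1: "qpoch q q (Suc l) * qpoch (a * b) q (Suc l) * qpoch (b / c) q (Suc (Suc l)) =
    (qpoch q q l * qpoch (a * b) q l * qpoch (b / c) q (Suc l)) *
    ((1 - q ^ Suc l) * (1 - a * b * q ^ l) * (1 - b / c * q ^ Suc l))"
    by (simp only: qpoch_Suc power_Suc mult_ac)
  have p2: "qpoch q q (Suc m) * qpoch (a * c) q (Suc m) * qpoch (c / b * q) q (Suc m) =
    (qpoch q q m * qpoch (a * c) q m * qpoch (c / b * q) q m) *
    ((1 - q ^ Suc m) * (1 - a * c * q ^ m) * (1 - c / b * q ^ Suc m))"
    by (simp only: qpoch_Suc power_Suc mult_ac)
  show ?thesis
    unfolding qb_coeff_def p1 p2 qpoch_Suc[of "a / c" q l] qpoch_Suc[of "a / b" q m] add_Suc add_Suc_right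
    by (rule gen) (use assms in auto)
qed

text \<open>In the second expansion, raising \<open>j\<close> lowers the first index by one and
  multiplies the second parameter by \<open>q\<close>. The factorials with shifted base change only
  in their end factors.\<close>

lemma qb_coeff_shift:
  assumes "q \<noteq> 0" "b \<noteq> 0" "q ^ Suc (l + m) \<noteq> 1" "q ^ Suc l \<noteq> 1"
    and "1 - a * c * q ^ (l + m) \<noteq> 0" "1 - a * b \<noteq> 0" "1 - b * c \<noteq> 0" "1 - b / c \<noteq> 0" "1 - c / b \<noteq> 0"
      "1 - a / c * q ^ l \<noteq> 0" "1 - a / (b * q) * q ^ m \<noteq> 0" "1 - c / b * q ^ m \<noteq> 0"
  shows "qb_coeff a (b * q) c q l m = qb_coeff a b c q (Suc l) m *
    ((1 - b * c) / ((1 - q ^ Suc (l + m)) * (1 - a * c * q ^ (l + m)))) *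
    ((1 - q ^ Suc l) * (1 - b / c) / (1 - a / c * q ^ l)) *
    ((1 - a / (b * q)) * (1 - c / b * q ^ m) / ((1 - a / (b * q) * q ^ m) * (1 - c / b)))"
proof -
  have gen: "Q * AC * AB / BC * L * (A / (Ql * ABl * BCl)) * (W * w / w' / (D * (E * e / e'))) =
     Q * q1 * (AC * ac) * (ab * AB) / (bc * BC) * L * (A * a1 / (Ql * ql * (ab * ABl) * (bc' * BCl))) * (W / (D * E)) *
     (bc / (q1 * ac)) * (ql * bc' / a1) * (w * e' / (w' * e))"
    if "q1 \<noteq> 0" "ac \<noteq> 0" "ab \<noteq> 0" "bc \<noteq> 0" "a1 \<noteq> 0" "ql \<noteq> 0" "bc' \<noteq> 0" "w' \<noteq> 0" 
    for Q AC AB BC L A Ql ABl BCl W D E q1 ac ab bc a1 ql bc' w w' e e' :: complex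
    using that by (simp add: mult_ac)
  have W: "qpoch (a / (b * q)) q m = qpoch (a / b) q m * (1 - a / (b * q)) / (1 - a / (b * q) * q ^ m)"
    using qpoch_divide_shift[of q "a / b" m] assms(1,11) by (simp add: field_simps)
  have E: "qpoch (c / b) q m = qpoch (c / b * q) q m * (1 - c / b) / (1 - c / b * q ^ m)"
    using qpoch_Suc[of "c / b" q m] qpoch_Suc_shift[of "c / b" q m] assms(12) by (simp add: field_simps)
  have R: "b * q * c = b * c * q" "a * (b * q) = a * b * q" "b * q / c = b / c * q" "c / (b * q) * q = c / b"
    "b / c * q * q ^ l = b / c * q ^ Suc l"
    using assms(1,2) by simp_all
  show ?thesis
    unfolding qb_coeff_def R W E add_Suc qpoch_Suc_shift[of "b / c" q "Suc l"] qpoch_Suc_shift[of "b * c"]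
      qpoch_Suc_shift[of "a * b"] qpoch_Suc[of q] qpoch_Suc[of "a * c"] qpoch_Suc[of "a / c"]
    by (simp only: power_Suc[symmetric]) (rule gen; use assms in simp)
qed

text \<open>With \<open>y = c / d\<close> this turns denominators of \<open>qb_coeff\<close> into
  those of \<open>Rcoef\<close>. Raising \<open>m\<close> shifts the base \<open>y / q ^ m\<close>
  by \<open>q\<close>, which \<open>qpoch_divide_shift\<close> expresses as an exchange of end
  factors.\<close>

lemma qpoch_well_poised:
  assumes "q \<noteq> 0" "y \<noteq> 0"
  shows "qpoch y q (Suc l) * qpoch (q / y) q m =
    (q ^ m - y * q ^ l) * q ^ (l * m) * qpoch (y / q ^ m) q l * qpoch (1 / (q ^ l * y)) q m"
proof (induction m)
  case 0
  show ?case
    by (simp add: qpoch_Suc)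
next
  case (Suc m)
  \<comment> \<open>The new linear factor supplies the last factor that
    \<open>qpoch_divide_shift\<close> exchanges for the first one.\<close>
  have "q ^ Suc m - y * q ^ l = q ^ Suc m * (1 - y / q ^ m / q * q ^ l)"
    using assms by (simp add: field_simps)
  then have "(q ^ Suc m - y * q ^ l) * q ^ (l * Suc m) * qpoch (y / q ^ Suc m) q l * qpoch (1 / (q ^ l * y)) q (Suc m) =
    q ^ Suc m * q ^ (l * m) * q ^ l * (qpoch (y / q ^ m / q) q l * (1 - y / q ^ m / q * q ^ l)) *
     (qpoch (1 / (q ^ l * y)) q m * (1 - 1 / (q ^ l * y) * q ^ m))"
    by (simp add: qpoch_Suc power_add mult_ac)
  also have "\<dots> = (q ^ l * (1 - 1 / (q ^ l * y) * q ^ m)) * (q ^ Suc m * (1 - y / q ^ m / q)) *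
      (q ^ (l * m) * qpoch (y / q ^ m) q l * qpoch (1 / (q ^ l * y)) q m)"
    unfolding qpoch_divide_shift[OF assms(1)] by (simp only: mult_ac)
  also have "(q ^ l * (1 - 1 / (q ^ l * y) * q ^ m)) * (q ^ Suc m * (1 - y / q ^ m / q)) =
     (1 - q / y * q ^ m) * (q ^ m - y * q ^ l)"
    using assms by (simp add: field_simps)
  also have "\<dots> * (q ^ (l * m) * qpoch (y / q ^ m) q l * qpoch (1 / (q ^ l * y)) q m) =
      qpoch y q (Suc l) * qpoch (q / y) q m * (1 - q / y * q ^ m)"
    unfolding Suc by (simp only: mult_ac)
  finally show ?case
    by (simp only: qpoch_Suc[of "q / y"] mult.assoc)
qed

text \<open>At \<open>l = 0\<close> the factorials of \<open>q\<close> and \<open>a * c\<close>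
  cancel, and the quotient of \<open>q ^ k - b / c\<close> by \<open>1 - b / c\<close> turns
  \<open>qpoch (c / b * q) q k\<close> into \<open>qpoch (c / b) q k\<close>.\<close>

lemma qb_coeff_0:
  assumes "c \<noteq> 0" "b \<noteq> 0" "c \<noteq> b" "qpoch q q k \<noteq> 0" "qpoch (a * c) q k \<noteq> 0" "1 - c / b * q ^ k \<noteq> 0"
  shows "qb_coeff a b c q 0 k = qpoch (a * b) q k * qpoch (a / b) q k / (qpoch (b * c) q k * qpoch (c / b) q k)"
proof -
  have z: "qpoch (c / b) q k * (1 - c / b * q ^ k) = (1 - c / b) * qpoch (c / b * q) q k"
    using qpoch_Suc[of "c / b" q k] qpoch_Suc_shift[of "c / b" q k] by simp
  have lin: "q ^ k - b / c = - (b / c) * (1 - c / b * q ^ k)" "1 - b / c = - (b / c) * (1 - c / b)"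
    using assms(1,2) by (simp_all add: field_simps)
  have nz: "1 - c / b \<noteq> 0"
    using assms(2,3) by auto
  have "1 / qpoch (c / b) q k = (q ^ k - b / c) / ((1 - b / c) * qpoch (c / b * q) q k)"
  proof -
    have "(q ^ k - b / c) / ((1 - b / c) * qpoch (c / b * q) q k) =
      (- (b / c) * (1 - c / b * q ^ k)) / (- (b / c) * ((1 - c / b) * qpoch (c / b * q) q k))"
      unfolding lin by (simp only: mult.assoc)
    also have "\<dots> = (1 - c / b * q ^ k) / ((1 - c / b) * qpoch (c / b * q) q k)"
      by (rule mult_divide_mult_cancel_left) (use assms in simp)
    also have "\<dots> = 1 / qpoch (c / b) q k"
      unfolding z[symmetric] using assms(6) by (rule nonzero_divide_mult_cancel_right)
    finally show ?thesis ..
  qed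
  then have "qpoch (a * b) q k * qpoch (a / b) q k / (qpoch (b * c) q k * qpoch (c / b) q k) =
    qpoch (a * b) q k * qpoch (a / b) q k / qpoch (b * c) q k * ((q ^ k - b / c) / ((1 - b / c) * qpoch (c / b * q) q k))"
    by (metis mult.right_neutral times_divide_times_eq)
  also have "\<dots> = qb_coeff a b c q 0 k"
    using assms(4,5) by (simp add: qb_coeff_def qpoch_Suc)
  finally show ?thesis ..
qed

lemma vwp_term_0: "A \<noteq> 1 \<Longrightarrow> vwp_term A bs q z 0 = 1"
proof -
  have "(\<Prod>b\<leftarrow>bs. 1) = (1 :: complex)"
    by (induction bs) auto
  then show "A \<noteq> 1 \<Longrightarrow> ?thesis"
    by (simp add: vwp_term_def)
qed

lemma vwp_term_Suc:
  assumes "1 - A * q ^ (2 * n) \<noteq> 0"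
  shows "vwp_term A bs q z (Suc n) = vwp_term A bs q z n *
    ((1 - A * q ^ (2 * Suc n)) / (1 - A * q ^ (2 * n)) * ((1 - A * q ^ n) * (\<Prod>b\<leftarrow>bs. 1 - b * q ^ n)) /
     ((1 - q ^ Suc n) * (\<Prod>b\<leftarrow>bs. 1 - A * q / b * q ^ n)) * z)"
proof -
  have p: "(\<Prod>b\<leftarrow>bs. qpoch (f b) q (Suc n)) = (\<Prod>b\<leftarrow>bs. qpoch (f b) q n) * (\<Prod>b\<leftarrow>bs. 1 - f b * q ^ n)" for f
    by (induction bs) (simp_all add: qpoch_Suc mult_ac)
  have "Y / W * (P * a * (R * r)) / (Q * c * (S * s)) * (z * Z) =
    X / W * (P * R) / (Q * S) * Z * (Y / X * (a * r) / (c * s) * z)" if "X \<noteq> 0"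
    for X Y W P R a r Q S c s Z :: complex
    using that by (simp add: mult_ac)
  note * = this[OF assms]
  show ?thesis
    unfolding vwp_term_def p[of "\<lambda>b. b"] p[of "\<lambda>b. A * q / b"] qpoch_Suc[of A] qpoch_Suc[of q]
      power_Suc[of z] power_Suc[of q n]
    by (rule *)
qed

text \<open>The left side is the product of the ratios from \<open>qb_coeff_move\<close> and
  \<open>qb_coeff_shift\<close>, the right side that of consecutive very-well-poised terms. Here
  \<open>x\<close>, \<open>K\<close>, \<open>L\<close>, \<open>M\<close> stand for the powers of
  \<open>q\<close> with exponents \<open>j\<close>, \<open>k-j-1\<close>, \<open>l-j-1\<close>,
  \<open>N-l\<close>, so \<open>B\<close> and \<open>Q\<close> are those with exponents
  \<open>N-k\<close> and \<open>N\<close>.\<close>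

lemma term_ratio_identity:
  fixes a b c d q x K L M :: complex
  assumes nz: "a \<noteq> 0" "b \<noteq> 0" "c \<noteq> 0" "d \<noteq> 0" "q \<noteq> 0" "x \<noteq> 0" "K \<noteq> 0" "L \<noteq> 0" "M \<noteq> 0"
    and g: "1 - c * x / d \<noteq> 0"
  defines "B \<equiv> M * L / K" and "Q \<equiv> M * L * q * x" and "k \<equiv> K * q * x" and "l \<equiv> L * q * x"
  defines "A \<equiv> c / (b * (M * L * q * x))"
  shows "((K - c / (b * B) * (q * x)) / (q * K - c / (b * B) * x)) *
    ((1 - a / (b * B) * x) / ((1 - q * x) * (1 - a * c * x) * (1 - c / (b * B) * (q * x)))) *
    ((1 - q * K) * (1 - a * (b * B) * K) * (1 - b * B / c * (q * K)) / (1 - a / c * K)) *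
    (((1 - c * x * d) / ((1 - q * (L * M)) * (1 - b * d * (L * M)))) *
    ((1 - q * L) * (1 - c * x / d) / (1 - b / d * L)) *
    ((1 - b / (c * x * q)) * (1 - d / (c * x) * M) / ((1 - b / (c * x * q) * M) * (1 - d / (c * x))))) =
    (1 - A * (q * x)\<^sup>2) / (1 - A * x\<^sup>2) * ((1 - A * x) *
      ((1 - 1 / k * x) * (1 - 1 / l * x) * (1 - k / Q * a / b * x) * (1 - l / Q * c / d * x) *
       (1 - c * d * x) * (1 - q / Q / (a * b) * x) * (1 - q * c / b * x))) /
     ((1 - q * x) *
      ((1 - A * q / (1 / k) * x) * (1 - A * q / (1 / l) * x) * (1 - A * q / (k / Q * a / b) * x) *
       (1 - A * q / (l / Q * c / d) * x) * (1 - A * q / (c * d) * x) * (1 - A * q / (q / Q / (a * b)) * x) *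
       (1 - A * q / (q * c / b) * x))) * q" (is "?lhs = ?rhs")
proof -
  \<comment> \<open>The \<open>e\<close> and \<open>f\<close> are the factors of the right side in
    their order there. Each factor on the left is a monomial times one of them or \<open>g1\<close>,
    whose two occurrences cancel.\<close>
  define e1 where "e1 = 1 - c * x * q / (b * M * L)"
  define e2 where "e2 = 1 - c * x / (b * M * L * q)"
  define e3 where "e3 = 1 - c / (b * M * L * q)"
  define e4 where "e4 = 1 - 1 / (K * q)"
  define e5 where "e5 = 1 - 1 / (L * q)"
  define e6 where "e6 = 1 - a * x * K / (b * M * L)"
  define e7 where "e7 = 1 - c * x / (d * M)"
  define e8 where "e8 = 1 - c * d * x"
  define e9 where "e9 = 1 - 1 / (a * b * M * L)"
  define e10 where "e10 = 1 - q * c * x / b"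
  define f1 where "f1 = 1 - q * x"
  define f2 where "f2 = 1 - c * q * x * K / (b * M * L)"
  define f3 where "f3 = 1 - c * q * x / (b * M)"
  define f4 where "f4 = 1 - c / (a * K)"
  define f5 where "f5 = 1 - d / (b * L)"
  define f6 where "f6 = 1 - 1 / (b * d * M * L)"
  define f7 where "f7 = 1 - a * c * x"
  define f8 where "f8 = 1 - 1 / (M * L * q)"
  define g1 where "g1 = 1 - c * x / d"
  have l: "K - c / (b * B) * (q * x) = K * e1" "q * K - c / (b * B) * x = q * K * e2"
    "1 - a / (b * B) * x = e6" "1 - c / (b * B) * (q * x) = f2"
    "1 - q * K = - (q * K) * e4" "1 - a * (b * B) * K = - (a * b * M * L) * e9"
    "1 - b * B / c * (q * K) = - (b * M * L * q / c) * e3" "1 - a / c * K = - (a * K / c) * f4"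
    "1 - c * x * d = e8" "1 - q * (L * M) = - (M * L * q) * f8" "1 - b * d * (L * M) = - (b * d * M * L) * f6"
    "1 - q * L = - (q * L) * e5" "1 - b / d * L = - (b * L / d) * f5"
    "1 - b / (c * x * q) = - (b / (c * x * q)) * e10" "1 - d / (c * x) * M = - (d * M / (c * x)) * e7"
    "1 - b / (c * x * q) * M = - (b * M / (c * x * q)) * f3" "1 - d / (c * x) = - (d / (c * x)) * g1"
    unfolding B_def e1_def e2_def e3_def e4_def e5_def e6_def e7_def e8_def e9_def e10_def
      f2_def f3_def f4_def f5_def f6_def f8_def g1_def
    using nz by (simp_all add: field_simps)
  have r: "1 - A * (q * x)\<^sup>2 = e1" "1 - A * x\<^sup>2 = e2" "1 - A * x = e3" "1 - 1 / k * x = e4" "1 - 1 / l * x = e5"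
    "1 - k / Q * a / b * x = e6" "1 - l / Q * c / d * x = e7" "1 - c * d * x = e8"
    "1 - q / Q / (a * b) * x = e9" "1 - q * c / b * x = e10"
    "1 - A * q / (1 / k) * x = f2" "1 - A * q / (1 / l) * x = f3" "1 - A * q / (k / Q * a / b) * x = f4"
    "1 - A * q / (l / Q * c / d) * x = f5" "1 - A * q / (c * d) * x = f6"
    "1 - A * q / (q / Q / (a * b)) * x = f7" "1 - A * q / (q * c / b) * x = f8"
    unfolding A_def Q_def k_def l_def e1_def e2_def e3_def e4_def e5_def e6_def e7_def e8_def e9_def e10_def
      f2_def f3_def f4_def f5_def f6_def f7_def f8_def
    using nz by (simp_all add: field_simps power2_eq_square)
  have g1: "g1 \<noteq> 0"
    using g by (simp add: g1_def)
  show ?thesis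
    unfolding l r unfolding f1_def[symmetric] f7_def[symmetric] g1_def[symmetric]
    using nz g1 by (simp add: mult_ac)
qed

subsection \<open>Genericity\<close>

lemma smult_sum_right: "smult x (\<Sum>i\<in>I. p i) = (\<Sum>i\<in>I. smult x (p i))"
  by (induction I rule: infinite_finite_induct) (simp_all add: smult_add_right)

text \<open>Closure properties of this predicate replace an explicit construction of the
  coefficients of the genericity polynomial.\<close>

definition is_poly5 :: "(complex \<Rightarrow> complex \<Rightarrow> complex \<Rightarrow> complex \<Rightarrow> complex \<Rightarrow> complex) \<Rightarrow> bool" where
  "is_poly5 f \<longleftrightarrow> (\<exists>C. finite {e. C e \<noteq> 0} \<and> mpoly5_eval C = f)"

lemma mpoly5_eval_superset:
  assumes "finite S" "{e. C e \<noteq> 0} \<subseteq> S"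
  shows "mpoly5_eval C a b c d q =
    (\<Sum>e\<in>S. case e of (i, j, k, l, m) \<Rightarrow> C e * a ^ i * b ^ j * c ^ k * d ^ l * q ^ m)"
  unfolding mpoly5_eval_def using assms by (intro sum.mono_neutral_left) auto

lemma is_poly5_monomial: "is_poly5 (\<lambda>a b c d q. x * a ^ i * b ^ j * c ^ k * d ^ l * q ^ m)"
proof -
  let ?C = "\<lambda>e. if e = (i, j, k, l, m) then x else 0"
  have "{e. ?C e \<noteq> 0} \<subseteq> {(i, j, k, l, m)}"
    by auto
  then have "finite {e. ?C e \<noteq> 0}"
    "mpoly5_eval ?C a b c d q = x * a ^ i * b ^ j * c ^ k * d ^ l * q ^ m" for a b c d q
    by (auto intro: finite_subset simp: mpoly5_eval_superset[of "{(i, j, k, l, m)}"])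
  then show ?thesis
    unfolding is_poly5_def by (intro exI[of _ ?C] conjI ext)
qed

lemma is_poly5_add:
  assumes "is_poly5 f" "is_poly5 g"
  shows "is_poly5 (\<lambda>a b c d q. f a b c d q + g a b c d q)"
proof -
  obtain C D where C: "finite {e. C e \<noteq> 0}" "mpoly5_eval C = f" and D: "finite {e. D e \<noteq> 0}" "mpoly5_eval D = g"
    using assms unfolding is_poly5_def by blast
  let ?S = "{e. C e \<noteq> 0} \<union> {e. D e \<noteq> 0}"
  have S: "finite ?S" "{e. C e + D e \<noteq> 0} \<subseteq> ?S"
    using C(1) D(1) by auto
  have "mpoly5_eval (\<lambda>e. C e + D e) a b c d q = f a b c d q + g a b c d q" for a b c d q
    unfolding C(2)[symmetric] D(2)[symmetric] mpoly5_eval_superset[OF S]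
      mpoly5_eval_superset[OF S(1) Un_upper1] mpoly5_eval_superset[OF S(1) Un_upper2] sum.distrib[symmetric]
    by (intro sum.cong) (auto simp: algebra_simps)
  then show ?thesis
    unfolding is_poly5_def
    by (intro exI[of _ "\<lambda>e. C e + D e"] conjI ext finite_subset[OF S(2,1)])
qed

lemma is_poly5_const: "is_poly5 (\<lambda>a b c d q. x)"
  using is_poly5_monomial[of x 0 0 0 0 0] by simp

lemma is_poly5_sum:
  assumes "\<And>i. i \<in> I \<Longrightarrow> is_poly5 (f i)"
  shows "is_poly5 (\<lambda>a b c d q. \<Sum>i\<in>I. f i a b c d q)"
  using assms
  by (induction I rule: infinite_finite_induct) (simp_all add: is_poly5_const is_poly5_add)

text \<open>Expanding the product of the two sums leaves a sum of monomials, which avoids convolving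
  the coefficient functions.\<close>

lemma is_poly5_mult:
  assumes "is_poly5 f" "is_poly5 g"
  shows "is_poly5 (\<lambda>a b c d q. f a b c d q * g a b c d q)"
proof -
  obtain C D where C: "mpoly5_eval C = f" and D: "mpoly5_eval D = g"
    using assms unfolding is_poly5_def by blast
  have "is_poly5 (\<lambda>a b c d q. (case e of (i, j, k, l, m) \<Rightarrow> C e * a ^ i * b ^ j * c ^ k * d ^ l * q ^ m) *
      (case e' of (i, j, k, l, m) \<Rightarrow> D e' * a ^ i * b ^ j * c ^ k * d ^ l * q ^ m))" for e e'
  proof -
    obtain i j k l m where e: "e = (i, j, k, l, m)"
      by (cases e)
    obtain i' j' k' l' m' where e': "e' = (i', j', k', l', m')"
      by (cases e')
    show ?thesis
      using is_poly5_monomial[of "C e * D e'" "i + i'" "j + j'" "k + k'" "l + l'" "m + m'"]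
      by (simp add: e e' power_add mult_ac)
  qed
  then show ?thesis
    unfolding C[symmetric] D[symmetric] mpoly5_eval_def sum_product by (intro is_poly5_sum)
qed

lemma is_poly5_var:
  "is_poly5 (\<lambda>a b c d q. a)" "is_poly5 (\<lambda>a b c d q. b)" "is_poly5 (\<lambda>a b c d q. c)"
  "is_poly5 (\<lambda>a b c d q. d)" "is_poly5 (\<lambda>a b c d q. q)"
  using is_poly5_monomial[of 1 1 0 0 0 0] is_poly5_monomial[of 1 0 1 0 0 0] is_poly5_monomial[of 1 0 0 1 0 0]
    is_poly5_monomial[of 1 0 0 0 1 0] is_poly5_monomial[of 1 0 0 0 0 1] by simp_all

lemma is_poly5_diff:
  assumes "is_poly5 f" "is_poly5 g"
  shows "is_poly5 (\<lambda>a b c d q. f a b c d q - g a b c d q)"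
  using is_poly5_add[OF assms(1) is_poly5_mult[OF is_poly5_const[of "-1"] assms(2)]] by simp

lemma is_poly5_power: "is_poly5 f \<Longrightarrow> is_poly5 (\<lambda>a b c d q. f a b c d q ^ n)"
  by (induction n) (simp_all add: is_poly5_const is_poly5_mult)

lemma is_poly5_prod:
  assumes "\<And>i. i \<in> I \<Longrightarrow> is_poly5 (f i)"
  shows "is_poly5 (\<lambda>a b c d q. \<Prod>i\<in>I. f i a b c d q)"
  using assms
  by (induction I rule: infinite_finite_induct) (simp_all add: is_poly5_const is_poly5_mult)

text \<open>The product of all expressions that must not vanish for a generic pair.\<close>

definition pair_discriminant :: "nat \<Rightarrow> complex \<Rightarrow> complex \<Rightarrow> complex \<Rightarrow> complex" where
  "pair_discriminant n q x y = x * y * (\<Prod>j\<le>n. (1 - x * y * q ^ j) * (x - y * q ^ j) * (y - x * q ^ j))"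

lemma pair_discriminant_nonzero_iff: "pair_discriminant n q x y \<noteq> 0 \<longleftrightarrow> generic_pair n q x y"
  by (auto simp: pair_discriminant_def generic_pair_def)

lemma is_poly5_pair_discriminant:
  assumes "is_poly5 f" "is_poly5 g"
  shows "is_poly5 (\<lambda>a b c d q. pair_discriminant n q (f a b c d q) (g a b c d q))"
  unfolding pair_discriminant_def
  by (intro is_poly5_mult is_poly5_prod is_poly5_diff is_poly5_power is_poly5_const is_poly5_var assms)

text \<open>Parity separates an odd integer from a multiple of a positive power of 2. This supplies
  a sample point at \<open>q = 2\<close>.\<close>

lemma generic_pair_odd:
  assumes "odd x" "odd y" "x \<noteq> y" "x > 1"
  shows "generic_pair n 2 (of_nat x) (of_nat y)"
proof -
  have "x * y * 2 ^ j \<noteq> 1" "x \<noteq> y * 2 ^ j" "y \<noteq> x * 2 ^ j" for j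
    using assms by (cases j; auto)+
  then have "of_nat (x * y * 2 ^ j) \<noteq> (of_nat 1 :: complex)" "of_nat x \<noteq> (of_nat (y * 2 ^ j) :: complex)"
    "of_nat y \<noteq> (of_nat (x * 2 ^ j) :: complex)" for j
    unfolding of_nat_eq_iff by blast+
  then show ?thesis
    using assms by (auto simp: generic_pair_def odd_pos)
qed

text \<open>The pairs among \<open>a\<close>, \<open>b\<close>, \<open>c\<close> serve the first
  expansion, those among \<open>b\<close>, \<open>c\<close>, \<open>d\<close> the second;
  \<open>q_power\<close> keeps \<open>qpoch q q n\<close> nonzero for
  \<open>n \<le> N\<close>.\<close>

locale generic_params =
  fixes a b c d q :: complex and N :: nat
  assumes q_nonzero: "q \<noteq> 0"
    and q_power: "\<And>j. j < N \<Longrightarrow> q ^ Suc j \<noteq> 1"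
    and gen_ab: "generic_pair N q a b" and gen_ac: "generic_pair N q a c" and gen_bc: "generic_pair N q b c"
    and gen_bd: "generic_pair N q b d" and gen_cd: "generic_pair N q c d"

lemma ex_poly5_generic_params:
  "\<exists>C. finite {e. C e \<noteq> 0} \<and> C \<noteq> (\<lambda>_. 0) \<and>
     (\<forall>a b c d q. mpoly5_eval C a b c d q \<noteq> 0 \<longrightarrow> generic_params a b c d q N)"
proof -
  define f where "f a b c d q = q * (\<Prod>j<N. 1 - q ^ Suc j) * pair_discriminant N q a b * pair_discriminant N q a c *
    pair_discriminant N q b c * pair_discriminant N q b d * pair_discriminant N q c d" for a b c d q
  have f: "f a b c d q \<noteq> 0 \<longleftrightarrow> generic_params a b c d q N" for a b c d q
    by (auto simp: f_def generic_params_def pair_discriminant_nonzero_iff simp del: power_Suc)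
  have "is_poly5 f"
    unfolding f_def
    by (intro is_poly5_mult is_poly5_pair_discriminant is_poly5_prod is_poly5_diff is_poly5_power is_poly5_const
        is_poly5_var)
  then obtain C where C: "finite {e. C e \<noteq> 0}" "mpoly5_eval C = f"
    unfolding is_poly5_def by blast
  \<comment> \<open>The point \<open>(3, 5, 7, 11, 2)\<close> witnesses that the polynomial is not
    zero.\<close>
  have "generic_pair N 2 3 5" "generic_pair N 2 3 7" "generic_pair N 2 5 7" "generic_pair N 2 5 11" "generic_pair N 2 7 11"
    using generic_pair_odd[of 3 5] generic_pair_odd[of 3 7] generic_pair_odd[of 5 7] generic_pair_odd[of 5 11]
      generic_pair_odd[of 7 11] by simp_all
  moreover have "2 ^ Suc j \<noteq> (1 :: complex)" for j
    using of_nat_eq_iff[of "2 ^ Suc j" 1, where ?'a = complex] by simp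
  ultimately have "f 3 5 7 11 2 \<noteq> 0"
    unfolding f generic_params_def by simp
  then have "C \<noteq> (\<lambda>_. 0)"
    unfolding C(2)[symmetric] by (auto simp: mpoly5_eval_def)
  with C f show ?thesis
    by auto
qed

section \<open>The iterated expansion\<close>

context generic_params
begin

lemma nonzero: "a \<noteq> 0" "b \<noteq> 0" "c \<noteq> 0" "d \<noteq> 0"
  using gen_ab gen_cd by (auto simp: generic_pair_def)

definition inner_coeff :: "nat \<Rightarrow> nat \<Rightarrow> complex" where
  "inner_coeff k j = qb_coeff a c (b * q ^ (N - k)) q j (k - j)"

text \<open>Indexed by the final index \<open>l = j + i\<close> instead of \<open>i\<close>, so that
  the terms for a fixed \<open>l\<close> can be collected.\<close>

definition outer_coeff :: "nat \<Rightarrow> nat \<Rightarrow> complex" where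
  "outer_coeff l j = qb_coeff b (c * q ^ j) d q (l - j) (N - l)"

lemma product_expansion:
  assumes k: "k \<le> N"
  shows "h_poly k a q * h_poly (N - k) b q =
    (\<Sum>l\<le>N. smult (\<Sum>j\<le>min k l. inner_coeff k j * outer_coeff l j) (h_poly l c q * h_poly (N - l) d q))"
proof -
  have 1: "h_poly k a q = (\<Sum>j\<le>k. smult (inner_coeff k j) (h_poly j c q * h_poly (k - j) (b * q ^ (N - k)) q))"
    unfolding inner_coeff_def
  proof (rule h_poly_expansion)
    show "generic_pair k q a c"
      using gen_ac k by (rule generic_pair_mono)
    show "generic_pair k q a (b * q ^ (N - k))" "generic_pair k q c (b * q ^ (N - k))"
      by (rule generic_pair_shift; use gen_ab gen_bc k q_nonzero in \<open>simp add: generic_pair_commute\<close>)+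
  qed (use q_nonzero q_power k in auto)
  have 2: "h_poly (N - j) b q =
     (\<Sum>i\<le>N - j. smult (outer_coeff (j + i) j) (h_poly i (c * q ^ j) q * h_poly (N - (j + i)) d q))" if "j \<le> N" for j
  proof -
    have "h_poly (N - j) b q =
       (\<Sum>i\<le>N - j. smult (qb_coeff b (c * q ^ j) d q i (N - j - i)) (h_poly i (c * q ^ j) q * h_poly (N - j - i) d q))"
    proof (rule h_poly_expansion)
      show "generic_pair (N - j) q b d"
        using gen_bd by (rule generic_pair_mono) simp
      show "generic_pair (N - j) q b (c * q ^ j)"
        by (rule generic_pair_shift; use gen_bc that q_nonzero in simp)
      have "generic_pair (N - j) q d (c * q ^ j)"
        by (rule generic_pair_shift; use gen_cd that q_nonzero in \<open>simp add: generic_pair_commute\<close>)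
      then show "generic_pair (N - j) q (c * q ^ j) d"
        by (simp add: generic_pair_commute)
    qed (use q_nonzero q_power in auto)
    then show ?thesis
      by (simp add: outer_coeff_def)
  qed
  let ?H = "\<lambda>l. h_poly l c q * h_poly (N - l) d q"
  have "h_poly k a q * h_poly (N - k) b q = (\<Sum>j\<le>k. smult (inner_coeff k j) (h_poly j c q * h_poly (N - j) b q))"
    unfolding 1 sum_distrib_right
  proof (intro sum.cong refl)
    fix j assume "j \<in> {..k}"
    \<comment> \<open>The shifted parameter \<open>b * q ^ (N - k)\<close> was chosen so that the
      two factors in \<open>b\<close> join into one.\<close>
    then have "h_poly (N - j) b q = h_poly (N - k) b q * h_poly (k - j) (b * q ^ (N - k)) q"
      using h_poly_add[of "N - k" "k - j" b q] k by simp
    then show "smult (inner_coeff k j) (h_poly j c q * h_poly (k - j) (b * q ^ (N - k)) q) * h_poly (N - k) b q =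
      smult (inner_coeff k j) (h_poly j c q * h_poly (N - j) b q)"
      by (simp add: mult_ac)
  qed
  \<comment> \<open>Here \<open>h_poly j c q\<close> joins the factor with parameter
    \<open>c * q ^ j\<close>. Writing the range of \<open>l\<close> as a restriction of
    \<open>{..N}\<close> prepares the interchange of sums.\<close>
  also have "\<dots> = (\<Sum>j\<le>k. \<Sum>l\<in>{l \<in> {..N}. j \<le> l}. smult (inner_coeff k j * outer_coeff l j) (?H l))"
  proof (intro sum.cong refl)
    fix j assume "j \<in> {..k}"
    then have j: "j \<le> N"
      using k by simp
    have "smult (inner_coeff k j) (h_poly j c q * h_poly (N - j) b q) =
      (\<Sum>i\<le>N - j. smult (inner_coeff k j * outer_coeff (j + i) j) (?H (j + i)))"
      unfolding 2[OF j] by (simp add: sum_distrib_left smult_sum_right h_poly_add mult_ac)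
    also have "\<dots> = (\<Sum>l\<in>{l \<in> {..N}. j \<le> l}. smult (inner_coeff k j * outer_coeff l j) (?H l))"
      by (rule sum.reindex_bij_witness[of _ "\<lambda>l. l - j" "\<lambda>i. j + i"]) (use j in auto)
    finally show "smult (inner_coeff k j) (h_poly j c q * h_poly (N - j) b q) = \<dots>" .
  qed
  also have "\<dots> = (\<Sum>l\<le>N. \<Sum>j\<in>{j \<in> {..k}. j \<le> l}. smult (inner_coeff k j * outer_coeff l j) (?H l))"
    by (rule sum.swap_restrict) simp_all
  also have "\<dots> = (\<Sum>l\<le>N. smult (\<Sum>j\<le>min k l. inner_coeff k j * outer_coeff l j) (?H l))"
  proof (intro sum.cong refl)
    fix l
    have "{j \<in> {..k}. j \<le> l} = {..min k l}"
      by auto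
    then show "(\<Sum>j\<in>{j \<in> {..k}. j \<le> l}. smult (inner_coeff k j * outer_coeff l j) (?H l)) =
      smult (\<Sum>j\<le>min k l. inner_coeff k j * outer_coeff l j) (?H l)"
      by (simp add: smult_sum)
  qed
  finally show ?thesis .
qed

end

subsection \<open>Identification of the coefficients\<close>

context generic_params
begin

abbreviation W_base :: complex where
  "W_base \<equiv> c / (b * q ^ N)"

abbreviation W_params :: "nat \<Rightarrow> nat \<Rightarrow> complex list" where
  "W_params k l \<equiv> [1 / q ^ k, 1 / q ^ l, q ^ k / q ^ N * a / b, q ^ l / q ^ N * c / d, c * d,
     q / q ^ N / (a * b), q * c / b]"

text \<open>The factor of \<open>Rcoef\<close> in front of the series, with negative powers of
  \<open>q\<close> written as reciprocals.\<close>

definition prefactor :: "nat \<Rightarrow> nat \<Rightarrow> complex" where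
  "prefactor k l = 1 / q ^ (l * (N - l)) * qbinom N l q *
     (qpoch (a * c) q k * qpoch (a / c) q k * qpoch (q ^ (N - l) * b * d) q l * qpoch (b / d) q l *
      qpoch (b / c) q (N - k) * qpoch (b / c) q (N - l) * qpoch (b * c) q (N - k)) /
     (qpoch (c / d / q ^ (N - l)) q l * qpoch (1 / (q ^ l * (c / d))) q (N - l) *
      qpoch (c * d) q N * qpoch (b / c) q N * qpoch (b * c) q l)"

text \<open>The parameters \<open>1 / q ^ k\<close> and \<open>1 / q ^ l\<close> make all terms
  beyond \<open>min k l\<close> vanish.\<close>

lemma Rcoef_eq:
  assumes "k \<le> N" "l \<le> N"
  shows "Rcoef a b c d N q k l = prefactor k l * (\<Sum>j\<le>min k l. vwp_term W_base (W_params k l) q q j)"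
proof -
  have powi: "q powi (- int n) = 1 / q ^ n" "q powi (int n - int m) = q ^ n / q ^ m" "q powi (1 - int m) = q / q ^ m" for n m
    using q_nonzero by (simp_all add: power_int_minus power_int_diff divide_inverse)
  have "q powi (int l * (int l - int N)) = q powi (- int (l * (N - l)))"
    using assms(2) by (simp add: of_nat_diff algebra_simps)
  then have p1: "q powi (int l * (int l - int N)) = 1 / q ^ (l * (N - l))"
    unfolding powi .
  have p2: "q ^ l / q ^ N * c / d = c / d / q ^ (N - l)" "1 / q ^ l * d / c = 1 / (q ^ l * (c / d))"
    "1 / q ^ N * c / b = c / (b * q ^ N)"
    using assms(2) q_nonzero nonzero by (simp_all add: power_diff mult_ac)
  have "vwp_term W_base (W_params k l) q q j = 0" if "j \<notin> {..min k l}" for j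
  proof -
    have "k < j \<or> l < j"
      using that by auto
    then have "qpoch (1 / q ^ k) q j = 0 \<or> qpoch (1 / q ^ l) q j = 0"
      using qpoch_eq_0[of "1 / q ^ k" q k j] qpoch_eq_0[of "1 / q ^ l" q l j] q_nonzero by auto
    then show ?thesis
      by (auto simp: vwp_term_def)
  qed
  then have "vwpW W_base (W_params k l) q q = (\<Sum>j\<le>min k l. vwp_term W_base (W_params k l) q q j)"
    unfolding vwpW_def by (intro suminf_finite) auto
  moreover have "Rcoef a b c d N q k l = prefactor k l * vwpW W_base (W_params k l) q q"
    unfolding Rcoef_def prefactor_def p1 powi p2(2,3) by (simp only: p2(1))
  ultimately show ?thesis
    by simp
qed

text \<open>The factorials of length \<open>N\<close> in \<open>b * c\<close>, \<open>b / c\<close>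
  and \<open>b * d\<close> are split so that the parts shared by the inner and outer coefficient
  cancel; \<open>qpoch_well_poised\<close> handles those in \<open>c / d\<close>.\<close>

lemma coeff_product_0:
  assumes k: "k \<le> N" and l: "l \<le> N"
  shows "inner_coeff k 0 * outer_coeff l 0 = prefactor k l"
proof -
  define e m where "e = N - k" and "m = N - l"
  have N: "N = e + k" "N = m + l" "l + m = N"
    using k l by (simp_all add: e_def m_def)
  have gen: "generic_pair k q a (b * q ^ e)" "generic_pair k q c (b * q ^ e)"
    by (rule generic_pair_shift; use gen_ab gen_bc k q_nonzero in \<open>simp add: generic_pair_commute e_def\<close>)+
  have "inner_coeff k 0 = qpoch (a * c) q k * qpoch (a / c) q k / (qpoch (c * (b * q ^ e)) q k * qpoch (b * q ^ e / c) q k)"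
    unfolding inner_coeff_def e_def[symmetric] diff_zero
  proof (rule qb_coeff_0)
    show "b * q ^ e \<noteq> c"
      using gen(2) by (auto simp: generic_pair_def)
    show "qpoch (a * (b * q ^ e)) q k \<noteq> 0"
      using gen(1) by (intro qpoch_nonzero) (auto simp: generic_pair_def)
    show "1 - b * q ^ e / c * q ^ k \<noteq> 0"
      using generic_pairD(3)[OF gen(2), of k] by simp
  qed (use q_nonzero nonzero q_power k in \<open>auto intro!: qpoch_q_nonzero\<close>)
  also have "c * (b * q ^ e) = b * c * q ^ e"
    by simp
  also have "b * q ^ e / c = b / c * q ^ e"
    by simp
  finally have i: "inner_coeff k 0 = qpoch (a * c) q k * qpoch (a / c) q k /
      (qpoch (b * c * q ^ e) q k * qpoch (b / c * q ^ e) q k)" .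
  have "b * c * q ^ j \<noteq> 1" "b / c * q ^ j \<noteq> 1" "b * d * q ^ j \<noteq> 1" if "j \<le> N" for j
    using generic_pairD[OF gen_bc that] generic_pairD[OF gen_bd that] by auto
  then have nz: "qpoch (b * c) q n \<noteq> 0" "qpoch (b / c) q n \<noteq> 0" "qpoch (b * d) q n \<noteq> 0" if "n \<le> N" for n
    using that by (auto intro!: qpoch_nonzero)
  have bc: "qpoch (b * c) q N = qpoch (b * c) q e * qpoch (b * c * q ^ e) q k"
    "qpoch (b / c) q N = qpoch (b / c) q e * qpoch (b / c * q ^ e) q k"
    "qpoch (b * d) q N = qpoch (b * d) q m * qpoch (b * d * q ^ m) q l"
    using N qpoch_add[of _ q] by metis+
  have wp: "qpoch (c / d) q (Suc l) * qpoch (d / c * q) q m =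
     (q ^ m - c / d * q ^ l) * q ^ (l * m) * qpoch (c / d / q ^ m) q l * qpoch (1 / (q ^ l * (c / d))) q m"
    using qpoch_well_poised[of q "c / d" l m] q_nonzero nonzero by (simp add: mult_ac)
  have lin: "q ^ m - c / d * q ^ l \<noteq> 0"
    by (rule generic_pair_diff[OF gen_cd q_nonzero]) (use l in \<open>auto simp: m_def\<close>)
  have "outer_coeff l 0 = qpoch q q N * qpoch (b * d) q N * qpoch (b * c) q N / qpoch (c * d) q N * (q ^ m - c / d * q ^ l) *
     (qpoch (b / d) q l / (qpoch q q l * qpoch (b * c) q l)) *
     (qpoch (b / c) q m / (qpoch q q m * qpoch (b * d) q m)) / (qpoch (c / d) q (Suc l) * qpoch (d / c * q) q m)"
    unfolding outer_coeff_def qb_coeff_def m_def[symmetric] N(3) diff_zero by simp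
  also have "\<dots> = 1 / q ^ (l * m) * (qpoch q q N / (qpoch q q l * qpoch q q m)) *
      (qpoch (b * d * q ^ m) q l * qpoch (b / d) q l * qpoch (b / c) q m * qpoch (b * c) q N) /
      (qpoch (c / d / q ^ m) q l * qpoch (1 / (q ^ l * (c / d))) q m * qpoch (c * d) q N * qpoch (b * c) q l)"
    unfolding wp bc(3) using lin nz[of m] N by (simp add: mult_ac)
  finally have o: "outer_coeff l 0 = \<dots>" .
  have R: "q ^ m * b * d = b * d * q ^ m"
    by simp
  have "qpoch (b * c) q e \<noteq> 0" "qpoch (b / c) q e \<noteq> 0" "qpoch (b * c * q ^ e) q k \<noteq> 0"
    using nz[of e] nz[of N] bc N by auto
  then show ?thesis
    unfolding prefactor_def e_def[symmetric] m_def[symmetric] i o R qbinom_def bc(1,2)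
    by (simp add: mult_ac)
qed

text \<open>The step from \<open>j\<close> to \<open>Suc j\<close> multiplies both sides by the same
  ratio, by \<open>term_ratio_identity\<close>. The form with a factor \<open>P\<close> keeps the
  terms themselves out of denominators.\<close>

lemma coeff_product_Suc:
  assumes j: "j < k" "j < l" and k: "k \<le> N" and l: "l \<le> N"
    and "inner_coeff k j * outer_coeff l j = P * vwp_term W_base (W_params k l) q q j"
  shows "inner_coeff k (Suc j) * outer_coeff l (Suc j) = P * vwp_term W_base (W_params k l) q q (Suc j)"
proof -
  define e m where "e = N - k" and "m = N - l"
  obtain k' l' where k': "k = Suc (j + k')" and l': "l = Suc (j + l')"
    using j less_iff_Suc_add by metis
  define x K L M where "x = q ^ j" and "K = q ^ k'" and "L = q ^ l'" and "M = q ^ m"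
  have nz: "x \<noteq> 0" "K \<noteq> 0" "L \<noteq> 0" "M \<noteq> 0"
    using q_nonzero by (simp_all add: x_def K_def L_def M_def)
  \<comment> \<open>Both exponents equal \<open>N - Suc j\<close>; this expresses
    \<open>q ^ (N - k)\<close> through the other powers.\<close>
  have "q ^ e * K = M * L"
    using k l unfolding K_def M_def L_def power_add[symmetric] by (simp add: e_def m_def k' l' add.commute)
  then have B: "q ^ e = M * L / K"
    using nz by (simp add: field_simps)
  have "N = m + l' + Suc j"
    using l by (simp add: m_def l')
  then have pN: "q ^ N = M * L * q * x"
    by (simp add: M_def L_def x_def power_add)
  have pk: "q ^ k = K * q * x" "q ^ l = L * q * x"
    by (simp_all add: k' l' K_def L_def x_def power_add)
  have gen1: "generic_pair k q a (b * q ^ e)" "generic_pair k q c (b * q ^ e)"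
    by (rule generic_pair_shift; use gen_ab gen_bc k q_nonzero in \<open>simp add: generic_pair_commute e_def\<close>)+
  have gen2: "generic_pair (N - i) q b (c * q ^ i)" "generic_pair (N - i) q d (c * q ^ i)" if "i \<le> N" for i
    by (rule generic_pair_shift; use gen_bc gen_cd that q_nonzero in \<open>simp add: generic_pair_commute\<close>)+
  have ij: "inner_coeff k j = qb_coeff a c (b * q ^ e) q j (Suc k')"
    by (simp add: inner_coeff_def e_def k')
  have "inner_coeff k (Suc j) = qb_coeff a c (b * q ^ e) q (Suc j) k'"
    by (simp add: inner_coeff_def e_def k')
  also have "\<dots> = inner_coeff k j *
    ((q ^ k' - c / (b * q ^ e) * q ^ Suc j) / (q ^ Suc k' - c / (b * q ^ e) * q ^ j)) *
    ((1 - a / (b * q ^ e) * q ^ j) / ((1 - q ^ Suc j) * (1 - a * c * q ^ j) * (1 - c / (b * q ^ e) * q ^ Suc j))) *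
    ((1 - q ^ Suc k') * (1 - a * (b * q ^ e) * q ^ k') * (1 - b * q ^ e / c * q ^ Suc k') / (1 - a / c * q ^ k'))"
    unfolding ij
  proof (rule qb_coeff_move)
    show "q ^ Suc j \<noteq> 1" "q ^ Suc k' \<noteq> 1"
      by (rule q_power; use j k k' in simp)+
    show "q ^ Suc k' - c / (b * q ^ e) * q ^ j \<noteq> 0"
      by (rule generic_pair_diff[OF gen1(2) q_nonzero]; use k' in simp)
    show "1 - a * c * q ^ j \<noteq> 0" "1 - a / c * q ^ k' \<noteq> 0"
      by (rule generic_pairD[OF gen_ac]; use k' k in simp)+
    show "1 - a * (b * q ^ e) * q ^ k' \<noteq> 0"
      by (rule generic_pairD[OF gen1(1)]) (use k' in simp)
    show "1 - c / (b * q ^ e) * q ^ Suc j \<noteq> 0" "1 - b * q ^ e / c * q ^ Suc k' \<noteq> 0"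
      by (rule generic_pairD[OF gen1(2)]; use k' in simp)+
  qed
  finally have i: "inner_coeff k (Suc j) = \<dots>" .
  have oj: "outer_coeff l j = qb_coeff b (c * q ^ j) d q (Suc l') m"
    by (simp add: outer_coeff_def m_def l')
  have "outer_coeff l (Suc j) = qb_coeff b (c * q ^ j * q) d q l' m"
    by (simp add: outer_coeff_def m_def l' mult_ac)
  also have "\<dots> = outer_coeff l j *
    ((1 - c * q ^ j * d) / ((1 - q ^ Suc (l' + m)) * (1 - b * d * q ^ (l' + m)))) *
    ((1 - q ^ Suc l') * (1 - c * q ^ j / d) / (1 - b / d * q ^ l')) *
    ((1 - b / (c * q ^ j * q)) * (1 - d / (c * q ^ j) * q ^ m) / ((1 - b / (c * q ^ j * q) * q ^ m) * (1 - d / (c * q ^ j))))"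
    unfolding oj
  proof (rule qb_coeff_shift)
    show "q ^ Suc (l' + m) \<noteq> 1" "q ^ Suc l' \<noteq> 1"
      by (rule q_power; use l l' in \<open>simp add: m_def\<close>)+
    show "1 - b * d * q ^ (l' + m) \<noteq> 0" "1 - b / d * q ^ l' \<noteq> 0"
      by (rule generic_pairD[OF gen_bd]; use l l' in \<open>simp add: m_def\<close>)+
    show "1 - b * (c * q ^ j) \<noteq> 0"
      using generic_pairD[OF gen2(1), of j 0] j l by simp
    show "1 - c * q ^ j * d \<noteq> 0" "1 - c * q ^ j / d \<noteq> 0" "1 - d / (c * q ^ j) \<noteq> 0"
      using generic_pairD[OF gen2(2), of j 0] j l by (simp_all add: mult_ac)
    show "1 - d / (c * q ^ j) * q ^ m \<noteq> 0"
      by (rule generic_pairD[OF gen2(2)]; use l l' in \<open>simp add: m_def\<close>)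
    have "1 - b / (c * q ^ Suc j) * q ^ m \<noteq> 0"
      by (rule generic_pairD[OF gen2(1)]; use l l' in \<open>simp add: m_def\<close>)
    then show "1 - b / (c * q ^ j * q) * q ^ m \<noteq> 0"
      by (simp add: mult_ac)
  qed (use q_nonzero nonzero in auto)
  finally have o: "outer_coeff l (Suc j) = \<dots>" .
  have g: "1 - c * x / d \<noteq> 0"
    using generic_pairD(2)[OF gen_cd, of j] j l by (simp add: x_def)
  \<comment> \<open>If this vanished, then \<open>b * q ^ (N - j) = c * q ^ j\<close>, contrary to
    genericity of \<open>b\<close> and \<open>c\<close>.\<close>
  have A: "1 - W_base * q ^ (2 * j) \<noteq> 0"
  proof
    assume "1 - W_base * q ^ (2 * j) = 0"
    then have "b * q ^ N = c * (q ^ j * q ^ j)"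
      using nonzero q_nonzero unfolding mult_2 power_add by (simp add: field_simps)
    moreover have "q ^ N = q ^ (N - j) * q ^ j"
      using j l by (simp flip: power_add)
    ultimately have "b * q ^ (N - j) = c * q ^ j"
      using q_nonzero by simp
    then show False
      using generic_pair_power_neq[OF gen_bc q_nonzero, of "N - j" j] j l by simp
  qed
  have pw: "q ^ (2 * Suc j) = (q * x)\<^sup>2" "q ^ (2 * j) = x\<^sup>2"
    by (simp_all add: x_def power_mult_distrib power_even_eq power2_eq_square)
  note ratio = term_ratio_identity[OF nonzero q_nonzero nz g]
  have "inner_coeff k (Suc j) * outer_coeff l (Suc j) = inner_coeff k j * outer_coeff l j *
    (((K - c / (b * (M * L / K)) * (q * x)) / (q * K - c / (b * (M * L / K)) * x)) *
    ((1 - a / (b * (M * L / K)) * x) / ((1 - q * x) * (1 - a * c * x) * (1 - c / (b * (M * L / K)) * (q * x)))) *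
    ((1 - q * K) * (1 - a * (b * (M * L / K)) * K) * (1 - b * (M * L / K) / c * (q * K)) / (1 - a / c * K)) *
    (((1 - c * x * d) / ((1 - q * (L * M)) * (1 - b * d * (L * M)))) *
    ((1 - q * L) * (1 - c * x / d) / (1 - b / d * L)) *
    ((1 - b / (c * x * q)) * (1 - d / (c * x) * M) / ((1 - b / (c * x * q) * M) * (1 - d / (c * x))))))"
    unfolding i o B power_Suc power_add x_def[symmetric] K_def[symmetric] L_def[symmetric] M_def[symmetric]
    by (simp only: mult_ac)
  also have "\<dots> = P * vwp_term W_base (W_params k l) q q (Suc j)"
    unfolding vwp_term_Suc[OF A] assms(5) unfolding ratio pw power_Suc x_def[symmetric] pN pk
    by (simp only: list.map prod_list.Cons prod_list.Nil mult_1_right mult.assoc)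
  finally show ?thesis .
qed

lemma Rcoef_eq_sum:
  assumes "k \<le> N" "l \<le> N"
  shows "Rcoef a b c d N q k l = (\<Sum>j\<le>min k l. inner_coeff k j * outer_coeff l j)"
proof -
  have "inner_coeff k j * outer_coeff l j = prefactor k l * vwp_term W_base (W_params k l) q q j"
    if "j \<le> min k l" for j
    using that
  proof (induction j)
    case 0
    have "W_base \<noteq> 1"
      using generic_pair_power_neq[OF gen_bc q_nonzero, of N 0] nonzero q_nonzero by auto
    then have "vwp_term W_base (W_params k l) q q 0 = 1"
      by (rule vwp_term_0)
    then show ?case
      using coeff_product_0[OF assms] by simp
  next
    case (Suc j)
    then show ?case
      using assms by (intro coeff_product_Suc) auto
  qed
  then show ?thesis
    unfolding Rcoef_eq[OF assms] sum_distrib_left by simp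
qed

section \<open>Existence and uniqueness of the expansion\<close>

lemma expansion_iff_Rcoef:
  assumes k: "k \<le> N"
  shows "h_poly k a q * h_poly (N - k) b q = (\<Sum>l\<le>N. smult (r l) (h_poly l c q * h_poly (N - l) d q)) \<longleftrightarrow>
    (\<forall>l\<le>N. r l = Rcoef a b c d N q k l)" (is "?lhs = ?sum r \<longleftrightarrow> _")
proof -
  have R: "?lhs = ?sum (Rcoef a b c d N q k)"
    using product_expansion[OF k] Rcoef_eq_sum[OF k] by simp
  have "r l = Rcoef a b c d N q k l" if "?lhs = ?sum r" "l \<le> N" for l
  proof -
    \<comment> \<open>Two expansions of the same product differ by a vanishing combination, to which
      linear independence applies.\<close>
    have "r l - Rcoef a b c d N q k l = 0"
    proof (rule h_poly_products_independent[of q c N d "\<lambda>l. r l - Rcoef a b c d N q k l"])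
      show "d * c * q ^ (i + j) \<noteq> 1" if "i + j < N" for i j
        using gen_cd that by (auto simp: generic_pair_def mult.commute)
      show "d * q ^ j \<noteq> c * q ^ i" if "i + j < N" for i j
        using generic_pair_power_neq[OF gen_cd q_nonzero, of i j] that by simp
      show "?sum (\<lambda>l. r l - Rcoef a b c d N q k l) = 0"
        using R that(1) by (simp add: smult_diff_left sum_subtractf)
    qed (use q_nonzero nonzero that in auto)
    then show ?thesis
      by simp
  qed
  moreover have "?lhs = ?sum r" if "\<forall>l\<le>N. r l = Rcoef a b c d N q k l"
    unfolding R using that by (intro sum.cong) auto
  ultimately show ?thesis
    by blast
qed

end

theorem mainTheorem3:
  fixes N :: nat
  shows "\<exists>C :: nat \<times> nat \<times> nat \<times> nat \<times> nat \<Rightarrow> complex.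
           finite {e. C e \<noteq> 0} \<and> C \<noteq> (\<lambda>_. 0) \<and>
           (\<forall>a b c d q. mpoly5_eval C a b c d q \<noteq> 0 \<longrightarrow>
              (\<forall>R :: nat \<Rightarrow> nat \<Rightarrow> complex.
                 (\<forall>k\<le>N. h_poly k a q * h_poly (N - k) b q =
                     (\<Sum>l\<le>N. smult (R k l) (h_poly l c q * h_poly (N - l) d q)))
                 \<longleftrightarrow> (\<forall>k\<le>N. \<forall>l\<le>N. R k l = Rcoef a b c d N q k l)))"
proof -
  \<comment> \<open>The nonempty Zariski-open set is the complement of the zero set of this nonzero
    polynomial.\<close>
  obtain C where C: "finite {e. C e \<noteq> 0}" "C \<noteq> (\<lambda>_. 0)"
    "\<And>a b c d q. mpoly5_eval C a b c d q \<noteq> 0 \<Longrightarrow> generic_params a b c d q N"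
    using ex_poly5_generic_params[of N] by blast
  show ?thesis
    by (intro exI[of _ C] conjI C(1,2) allI impI) (simp add: generic_params.expansion_iff_Rcoef[OF C(3)])
qed

end
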